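(* For each $n\geq 2$, $$\max_{\equiv}\ \max_{w\in S_n}\ \lvert D_R(\mathbf S_\equiv(w))\rvert=n-2,$$ where the first maximum is over all essential semilattice congruences $\equiv$ on the left weak order of the symmetric group $S_n$.
   Context: $S_n$ is the symmetric group, with simple generators $s_i=(i\;\,i+1)$, $1\le i\le n-1$; products are compositions of functions and $\ell$ is Coxeter length. The left weak order is $x\leq_L y \iff \ell(yx^{-1})=\ell(y)-\ell(x)$; $x\wedge y$ denotes the meet in this order. The right descent set is $D_R(w)=\{s_i:\ell(ws_i)<\ell(w)\}=\{s_i: w(i)>w(i+1)\}$. A semilattice congruence on a meet-semilattice is an equivalence relation $\equiv$ such that $x_1\equiv x_2$ and $y_1\equiv y_2$ imply $x_1\wedge y_1\equiv x_2\wedge y_2$. It is essential (on $(S_n,\leq_L)$) if the identity $e$ forms a singleton congruence class. Every congruence class has a unique minimal element; $\pi_\downarrow^\equiv(w)$ denotes the minimal element of the class of $w$. The Coxeter stack-sorting operator is $\mathbf S_\equiv:S_n\to S_n$, $\mathbf S_\equiv(w)=w\,(\pi_\downarrow^\equiv(w))^{-1}$. *)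

theory Defs
  imports "HOL-Combinatorics.Permutations" "HOL-Algebra.Lattice"
begin

definition symmetric_group :: "nat \<Rightarrow> (nat \<Rightarrow> nat) set" where
  "symmetric_group n = {w. w permutes {1..n}}"

definition simple_gen :: "nat \<Rightarrow> nat \<Rightarrow> nat" where
  "simple_gen i = transpose i (Suc i)"

definition word_prod :: "nat list \<Rightarrow> nat \<Rightarrow> nat" where
  "word_prod is = foldr (\<circ>) (map simple_gen is) id"

text \<open>Coxeter length: the least length of a word in the simple generators representing \<open>w\<close>.
  It is only meaningful for \<open>w \<in> symmetric_group n\<close>, where such a word exists.\<close>

definition coxeter_length :: "nat \<Rightarrow> (nat \<Rightarrow> nat) \<Rightarrow> nat" where
  "coxeter_length n w =
     (LEAST k. \<exists>is. length is = k \<and> set is \<subseteq> {1..<n} \<and> word_prod is = w)"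

text \<open>The length condition of the order is stated over the integers, so that the difference is
  not truncated.\<close>

definition left_weak_order :: "nat \<Rightarrow> (nat \<Rightarrow> nat) gorder" where
  "left_weak_order n =
     \<lparr>carrier = symmetric_group n, eq = (=),
      le = (\<lambda>x y. int (coxeter_length n (y \<circ> inv x)) =
                    int (coxeter_length n y) - int (coxeter_length n x))\<rparr>"

definition right_descents :: "nat \<Rightarrow> (nat \<Rightarrow> nat) \<Rightarrow> (nat \<Rightarrow> nat) set" where
  "right_descents n w =
     {simple_gen i | i. i \<in> {1..<n} \<and> coxeter_length n (w \<circ> simple_gen i) < coxeter_length n w}"

definition semilattice_congruence :: "('a, 'b) gorder_scheme \<Rightarrow> 'a rel \<Rightarrow> bool" where
  "semilattice_congruence L r \<longleftrightarrow>
     equiv (carrier L) r \<and>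
     (\<forall>x1 x2 y1 y2. (x1, x2) \<in> r \<and> (y1, y2) \<in> r \<longrightarrow>
        (x1 \<sqinter>\<^bsub>L\<^esub> y1, x2 \<sqinter>\<^bsub>L\<^esub> y2) \<in> r)"

definition essential_congruence :: "nat \<Rightarrow> (nat \<Rightarrow> nat) rel \<Rightarrow> bool" where
  "essential_congruence n r \<longleftrightarrow>
     semilattice_congruence (left_weak_order n) r \<and> r `` {id} = {id}"

definition pi_down :: "('a, 'b) gorder_scheme \<Rightarrow> 'a rel \<Rightarrow> 'a \<Rightarrow> 'a" where
  "pi_down L r w = (THE u. u \<in> r `` {w} \<and> (\<forall>v \<in> r `` {w}. v \<sqsubseteq>\<^bsub>L\<^esub> u \<longrightarrow> v = u))"

definition stack_sort :: "nat \<Rightarrow> (nat \<Rightarrow> nat) rel \<Rightarrow> (nat \<Rightarrow> nat) \<Rightarrow> (nat \<Rightarrow> nat)" where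
  "stack_sort n r w = w \<circ> inv (pi_down (left_weak_order n) r w)"

end

theory Submission
  imports Defs
begin

text \<open>The left weak order is containment of inversion sets (taken on positions). If all simple
  generators were descents of \<open>v = w u\<^sup>-\<^sup>1\<close>, with \<open>u\<close> minimal in the class of \<open>w\<close>, then \<open>v\<close> would
  reverse the order, so no inversion of \<open>u\<close> could be an inversion of \<open>w\<close>; since \<open>u \<le> w\<close>, this
  forces \<open>u\<close>, hence \<open>w\<close>, to be the identity.

  For sharpness, comparing two elements by their descents and by whether they lie above a fixed \<open>u\<close>
  is an essential semilattice congruence, and \<open>u\<close> is the minimal element of the class of any
  \<open>w \<ge> u\<close> with the same descents. With \<open>k = \<lceil>n/2\<rceil>\<close>, take \<open>u = 1, k+1, 2, k+2, \<dots>\<close> and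
  \<open>w = k, n, k-1, n-1, \<dots>\<close>, so that \<open>w u\<^sup>-\<^sup>1 = k, \<dots>, 1, n, \<dots>, k+1\<close>.\<close>

section \<open>Inversion sets of permutations\<close>

definition inversions :: "(nat \<Rightarrow> nat) \<Rightarrow> (nat \<times> nat) set" where
  "inversions w = {(i, j). i < j \<and> w j < w i}"

text \<open>Pairs in \<open>inversions\<close> range over all naturals, but a fixed point outside
  \<open>{1..n}\<close> belongs to none: nothing lies below 0, and a point beyond \<open>n\<close>
  exceeds all smaller positions in value as well.\<close>

lemma inversions_subset:
  assumes "w permutes {1..n}"
  shows "inversions w \<subseteq> {1..n} \<times> {1..n}"
proof (clarify)
  fix i j assume "(i, j) \<in> inversions w"
  then have ij: "i < j" "w j < w i" by (auto simp: inversions_def)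
  have "i \<in> {1..n}"
  proof (rule ccontr)
    assume i: "i \<notin> {1..n}"
    then have "w i = i" using assms by (simp add: permutes_def)
    with ij i have "w j \<notin> {1..n} \<or> j \<notin> {1..n}" by auto
    then have "j \<notin> {1..n}" using permutes_in_image[OF assms] by blast
    then have "w j = j" using assms by (simp add: permutes_def)
    with ij \<open>w i = i\<close> show False by simp
  qed
  moreover have "j \<in> {1..n}"
  proof (rule ccontr)
    assume "j \<notin> {1..n}"
    then have "w j = j" using assms by (simp add: permutes_def)
    moreover have "w i \<le> n"
      using \<open>i \<in> {1..n}\<close> permutes_in_image[OF assms, of i] by simp
    ultimately show False using ij \<open>j \<notin> {1..n}\<close> by auto
  qed
  ultimately show "i \<in> {1..n} \<and> j \<in> {1..n}" by simp
qed

lemma finite_inversions: "w permutes {1..n} \<Longrightarrow> finite (inversions w)"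
  using inversions_subset finite_subset by blast

lemma inversions_id [simp]: "inversions id = {}"
  by (auto simp: inversions_def)

text \<open>Both \<open>w\<close> and its inverse are then strictly increasing on the naturals, so
  \<open>i \<le> w i \<le> inv w (w i) = i\<close>.\<close>

lemma inversions_empty_imp_id:
  assumes "w permutes {1..n}" "inversions w = {}"
  shows "w = id"
proof
  fix i
  have inj: "inj w" and w: "w (inv w j) = j" "inv w (w j) = j" for j
    using assms(1) by (auto simp: permutes_inj permutes_inverses)
  have less: "w a < w b" if "a < b" for a b
  proof -
    have "\<not> w b < w a" using assms(2) that by (auto simp: inversions_def)
    moreover have "w a \<noteq> w b" using inj that by (auto dest: injD)
    ultimately show ?thesis by simp
  qed
  then have "strict_mono w" by (simp add: strict_mono_def)
  moreover have "strict_mono (inv w)"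
  proof (rule strict_monoI)
    fix a b :: nat assume "a < b"
    then show "inv w a < inv w b"
      using less[of "inv w b" "inv w a"] w(1) by (metis linorder_neqE_nat not_less_iff_gr_or_eq)
  qed
  ultimately have "i \<le> w i" "w i \<le> inv w (w i)" by (auto intro: strict_mono_imp_increasing)
  then show "w i = id i" by (simp add: w(2))
qed

text \<open>A pair of positions is sent by \<open>q\<close> to a pair of values, sorted by
  \<open>min\<close> and \<open>max\<close>. Then \<open>p\<close> inverts that pair of values
  exactly when \<open>q\<close> and \<open>p \<circ> q\<close> disagree on whether the positions
  form an inversion.\<close>

lemma bij_betw_inversions_comp:
  assumes "p permutes {1..n}" "q permutes {1..n}"
  shows "bij_betw (\<lambda>(i, j). (min (q i) (q j), max (q i) (q j)))
           (sym_diff (inversions q) (inversions (p \<circ> q))) (inversions p)"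
proof -
  have q: "q (inv q a) = a" "inv q (q a) = a" for a
    using assms(2) by (auto simp: permutes_inverses)
  have inj: "q a = q b \<longleftrightarrow> a = b" "p a = p b \<longleftrightarrow> a = b" for a b
    using assms by (metis permutes_inverses(2))+
  have injq: "inv q a = inv q b \<longleftrightarrow> a = b" for a b
    by (metis q(1))
  have q_inv: "min (inv q (min (q i) (q j))) (inv q (max (q i) (q j))) = i"
      "max (inv q (min (q i) (q j))) (inv q (max (q i) (q j))) = j" if "i < j" for i j
    using that by (cases "q i \<le> q j"; simp add: min_def max_def q)+
  have inv_q: "min (q (min (inv q a) (inv q b))) (q (max (inv q a) (inv q b))) = a"
      "max (q (min (inv q a) (inv q b))) (q (max (inv q a) (inv q b))) = b" if "a < b" for a b
    using that by (cases "inv q a \<le> inv q b"; simp add: min_def max_def q)+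
  have image_mem: "(min (q i) (q j), max (q i) (q j)) \<in> inversions p"
    if ij: "(i, j) \<in> sym_diff (inversions q) (inversions (p \<circ> q))" for i j
  proof -
    have "q i \<noteq> q j" "p (q i) \<noteq> p (q j)" using ij by (auto simp: inversions_def inj)
    with ij show ?thesis
      by (cases "q i < q j") (auto simp: inversions_def min_def max_def)
  qed
  have preimage_mem: "(min (inv q a) (inv q b), max (inv q a) (inv q b))
      \<in> sym_diff (inversions q) (inversions (p \<circ> q))"
    if ab: "(a, b) \<in> inversions p" for a b
  proof -
    have "inv q a \<noteq> inv q b" using ab by (auto simp: inversions_def injq)
    with ab show ?thesis
      by (cases "inv q a < inv q b") (auto simp: inversions_def min_def max_def q)
  qed
  show ?thesis
  proof (rule bij_betw_byWitness[where f' =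
      "\<lambda>(a, b). (min (inv q a) (inv q b), max (inv q a) (inv q b))"], goal_cases)
    case 1
    then show ?case by (auto simp: inversions_def q_inv q)
  next
    case 2
    then show ?case by (auto simp: inversions_def inv_q q)
  next
    case 3
    show ?case
    proof (rule image_subsetI)
      fix z assume "z \<in> sym_diff (inversions q) (inversions (p \<circ> q))"
      then show "(case z of (i, j) \<Rightarrow> (min (q i) (q j), max (q i) (q j))) \<in> inversions p"
        using image_mem[of "fst z" "snd z"] by (simp only: split_beta prod.collapse)
    qed
  next
    case 4
    show ?case
    proof (rule image_subsetI)
      fix z assume "z \<in> inversions p"
      then show "(case z of (a, b) \<Rightarrow> (min (inv q a) (inv q b), max (inv q a) (inv q b)))
          \<in> sym_diff (inversions q) (inversions (p \<circ> q))"
        using preimage_mem[of "fst z" "snd z"] by (simp only: split_beta prod.collapse)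
    qed
  qed
qed

lemma card_inversions_comp:
  assumes "p permutes {1..n}" "q permutes {1..n}"
  shows "card (inversions p) = card (sym_diff (inversions q) (inversions (p \<circ> q)))"
  using bij_betw_same_card[OF bij_betw_inversions_comp[OF assms]] by simp

text \<open>An inversion of \<open>p \<circ> q\<close> either is one of \<open>q\<close> or lies in
  the symmetric difference, which \<open>p\<close> counts.\<close>

lemma card_inversions_comp_le:
  assumes "p permutes {1..n}" "q permutes {1..n}"
  shows "card (inversions (p \<circ> q)) \<le> card (inversions p) + card (inversions q)"
proof -
  have fin: "finite (inversions q)" "finite (inversions (p \<circ> q))"
    using assms permutes_compose[OF assms(2,1)] by (auto intro: finite_inversions)
  have "card (inversions (p \<circ> q))
      \<le> card (sym_diff (inversions q) (inversions (p \<circ> q)) \<union> inversions q)"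
    using fin by (intro card_mono) auto
  also have "\<dots> \<le> card (sym_diff (inversions q) (inversions (p \<circ> q))) + card (inversions q)"
    by (rule card_Un_le)
  finally show ?thesis using card_inversions_comp[OF assms] by simp
qed

section \<open>Coxeter length and descents in terms of inversions\<close>

lemma simple_gen_permutes: "i \<in> {1..<n} \<Longrightarrow> simple_gen i permutes {1..n}"
  unfolding simple_gen_def by (rule permutes_swap_id) auto

lemma simple_gen_comp_self: "simple_gen i \<circ> simple_gen i = id"
  by (simp add: simple_gen_def)

lemma inversions_simple_gen: "inversions (simple_gen i) = {(i, Suc i)}"
  by (auto simp: inversions_def simple_gen_def transpose_def split: if_splits)

lemma card_inversions_comp_simple_gen:
  assumes "w permutes {1..n}" "i \<in> {1..<n}"
  shows "card (inversions (w \<circ> simple_gen i)) =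
    (if w (Suc i) < w i then card (inversions w) - 1 else card (inversions w) + 1)"
proof -
  have s: "simple_gen i permutes {1..n}" using assms(2) by (rule simple_gen_permutes)
  \<comment> \<open>The counting formula is applied with \<open>p = w \<circ> simple_gen i\<close>
    and \<open>q = simple_gen i\<close>, so that \<open>p \<circ> q\<close> is \<open>w\<close>
    again.\<close>
  have "card (inversions (w \<circ> simple_gen i)) =
      card (sym_diff {(i, Suc i)} (inversions (w \<circ> simple_gen i \<circ> simple_gen i)))"
    using card_inversions_comp[OF permutes_compose[OF s assms(1)] s]
    by (simp add: inversions_simple_gen)
  also have "w \<circ> simple_gen i \<circ> simple_gen i = w"
    by (simp add: comp_assoc simple_gen_comp_self)
  finally have *: "card (inversions (w \<circ> simple_gen i)) =
      card (sym_diff {(i, Suc i)} (inversions w))" .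
  have mem: "(i, Suc i) \<in> inversions w \<longleftrightarrow> w (Suc i) < w i" by (simp add: inversions_def)
  show ?thesis
  proof (cases "w (Suc i) < w i")
    case True
    then have "sym_diff {(i, Suc i)} (inversions w) = inversions w - {(i, Suc i)}"
      using mem by auto
    with True mem * show ?thesis by (simp add: card_Diff_singleton)
  next
    case False
    then have "sym_diff {(i, Suc i)} (inversions w) = insert (i, Suc i) (inversions w)"
      using mem by auto
    with False mem * show ?thesis using finite_inversions[OF assms(1)] by simp
  qed
qed

text \<open>Descents split off generators on the right, whereas \<open>foldr\<close> unfolds a word
  from the left.\<close>

lemma word_prod_snoc: "word_prod (is @ [i]) = word_prod is \<circ> simple_gen i"
proof -
  have "foldr (\<circ>) xs f = foldr (\<circ>) xs id \<circ> f" for xs :: "(nat \<Rightarrow> nat) list" and f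
    by (induction xs) (auto simp: comp_assoc)
  from this[of "map simple_gen is" "simple_gen i"] show ?thesis
    by (simp add: word_prod_def)
qed

text \<open>Each further letter adds at most one inversion; this is the lower bound on the
  length.\<close>

lemma card_inversions_word_prod_le:
  assumes "set is \<subseteq> {1..<n}"
  shows "word_prod is permutes {1..n} \<and> card (inversions (word_prod is)) \<le> length is"
  using assms
proof (induction "is" rule: rev_induct)
  case Nil
  have "word_prod [] = id" by (simp add: word_prod_def)
  then show ?case by (simp only: permutes_id inversions_id card.empty list.size le_refl)
next
  case (snoc i "is")
  then have w: "word_prod is permutes {1..n}" and le: "card (inversions (word_prod is)) \<le> length is"
    and s: "simple_gen i permutes {1..n}"
    using simple_gen_permutes[of i n] by auto
  have "card (inversions (word_prod is \<circ> simple_gen i)) \<le> length (is @ [i])"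
    using le card_inversions_comp_le[OF w s] by (simp add: inversions_simple_gen)
  then show ?case
    unfolding word_prod_snoc using permutes_compose[OF s w] by blast
qed

lemma no_descent_imp_id:
  assumes "w permutes {1..n}" "\<And>i. i \<in> {1..<n} \<Longrightarrow> w i \<le> w (Suc i)"
  shows "w = id"
proof (rule inversions_empty_imp_id[OF assms(1)])
  have "w a \<le> w b" if "a \<le> b" "1 \<le> a" "b \<le> n" for a b
    using that
  proof (induction b rule: dec_induct)
    case (step m)
    then show ?case using assms(2)[of m] by force
  qed simp
  moreover have "i < j" "w j < w i" "1 \<le> i" "j \<le> n" if "(i, j) \<in> inversions w" for i j
    using that subsetD[OF inversions_subset[OF assms(1)] that] by (auto simp: inversions_def)
  ultimately have "(i, j) \<notin> inversions w" for i j
    by (meson less_imp_le_nat not_less)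
  then show "inversions w = {}" by auto
qed

text \<open>Bubble sort: as long as \<open>w\<close> is not the identity it has a descent, and
  multiplying by that generator on the right removes exactly one inversion.\<close>

lemma obtain_reduced_word:
  assumes "w permutes {1..n}"
  obtains "is" where "set is \<subseteq> {1..<n}" "word_prod is = w" "length is = card (inversions w)"
proof -
  have "\<exists>is. set is \<subseteq> {1..<n} \<and> word_prod is = w \<and> length is = card (inversions w)"
    using assms
  proof (induction "card (inversions w)" arbitrary: w)
    case 0
    then have "w = id" using finite_inversions inversions_empty_imp_id by fastforce
    then show ?case using 0 by (intro exI[of _ "[]"]) (simp add: word_prod_def)
  next
    case (Suc k)
    have "w \<noteq> id" using Suc.hyps(2) by (metis card.empty inversions_id nat.distinct(1))
    then obtain i where i: "i \<in> {1..<n}" "w (Suc i) < w i"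
      using no_descent_imp_id[OF Suc.prems] by (metis not_less)
    let ?v = "w \<circ> simple_gen i"
    have "k = card (inversions ?v)"
      using card_inversions_comp_simple_gen[OF Suc.prems i(1)] i(2) Suc.hyps(2) by simp
    moreover have "?v permutes {1..n}"
      by (rule permutes_compose[OF simple_gen_permutes[OF i(1)] Suc.prems])
    ultimately obtain "is" where "set is \<subseteq> {1..<n}" "word_prod is = ?v" "length is = k"
      using Suc.hyps(1) by blast
    then show ?case using i Suc.hyps(2)
      by (intro exI[of _ "is @ [i]"])
        (auto simp: word_prod_snoc comp_assoc simple_gen_comp_self)
  qed
  with that show ?thesis by blast
qed

lemma coxeter_length_eq_card_inversions:
  assumes "w permutes {1..n}"
  shows "coxeter_length n w = card (inversions w)"
  unfolding coxeter_length_def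
proof (rule Least_equality)
  show "\<exists>is. length is = card (inversions w) \<and> set is \<subseteq> {1..<n} \<and> word_prod is = w"
    using obtain_reduced_word[OF assms] by metis
next
  fix k assume "\<exists>is. length is = k \<and> set is \<subseteq> {1..<n} \<and> word_prod is = w"
  then show "card (inversions w) \<le> k" using card_inversions_word_prod_le by blast
qed

lemma right_descents_eq:
  assumes "w permutes {1..n}"
  shows "right_descents n w = simple_gen ` {i \<in> {1..<n}. w (Suc i) < w i}"
proof -
  have "coxeter_length n (w \<circ> simple_gen i) < coxeter_length n w \<longleftrightarrow> w (Suc i) < w i"
    if i: "i \<in> {1..<n}" for i
  proof -
    \<comment> \<open>Positivity keeps \<open>card (inversions w) - 1\<close> from truncating, so
      the length really drops at a descent.\<close>
    have "card (inversions w) > 0" if "w (Suc i) < w i"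
      using that finite_inversions[OF assms] by (auto simp: card_gt_0_iff inversions_def)
    then show ?thesis
      using card_inversions_comp_simple_gen[OF assms i]
        permutes_compose[OF simple_gen_permutes[OF i] assms] assms
      by (auto simp: coxeter_length_eq_card_inversions)
  qed
  then show ?thesis by (auto simp: right_descents_def)
qed

text \<open>The index is read off the unique inversion. Hence counting descents as generators agrees
  with counting them as positions.\<close>

lemma inj_simple_gen: "inj simple_gen"
  by (rule injI) (metis inversions_simple_gen prod.inject singleton_inject)

lemma card_right_descents:
  assumes "w permutes {1..n}"
  shows "card (right_descents n w) = card {i \<in> {1..<n}. w (Suc i) < w i}"
  unfolding right_descents_eq[OF assms]
  by (rule card_image) (rule inj_on_subset[OF inj_simple_gen subset_UNIV])

section \<open>The left weak order as containment of inversion sets\<close>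

lemma left_weak_order_simps [simp]:
  "carrier (left_weak_order n) = symmetric_group n"
  "eq (left_weak_order n) = (=)"
  by (simp_all add: left_weak_order_def)

text \<open>The length of \<open>y \<circ> inv x\<close> is the size of the symmetric difference of
  the two inversion sets. It equals the difference of their sizes exactly when no inversion of
  \<open>x\<close> is missing from \<open>y\<close>.\<close>

lemma left_weak_order_le_iff:
  assumes "x \<in> symmetric_group n" "y \<in> symmetric_group n"
  shows "x \<sqsubseteq>\<^bsub>left_weak_order n\<^esub> y \<longleftrightarrow> inversions x \<subseteq> inversions y"
proof -
  have x: "x permutes {1..n}" and y: "y permutes {1..n}"
    using assms by (auto simp: symmetric_group_def)
  have yx: "y \<circ> inv x permutes {1..n}"
    by (rule permutes_compose[OF permutes_inv[OF x] y])
  have fin: "finite (inversions x)" "finite (inversions y)"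
    using x y by (auto intro: finite_inversions)
  have "y \<circ> inv x \<circ> x = y" using x by (simp add: comp_assoc permutes_inv_o)
  then have "card (inversions (y \<circ> inv x)) = card (sym_diff (inversions x) (inversions y))"
    using card_inversions_comp[OF yx x] by simp
  also have "\<dots> = card (inversions x - inversions y) + card (inversions y - inversions x)"
    using fin by (intro card_Un_disjoint) auto
  finally have "card (inversions (y \<circ> inv x)) =
      card (inversions x - inversions y) + card (inversions y - inversions x)" .
  moreover have "card (inversions x) = card (inversions x - inversions y) + card (inversions x \<inter> inversions y)"
    "card (inversions y) = card (inversions y - inversions x) + card (inversions x \<inter> inversions y)"
    using fin by (metis card_Diff_subset_Int card_Int_Diff add.commute Int_commute)+
  ultimately have "x \<sqsubseteq>\<^bsub>left_weak_order n\<^esub> y \<longleftrightarrow> card (inversions x - inversions y) = 0"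
    unfolding left_weak_order_def
    by (auto simp: coxeter_length_eq_card_inversions[OF x] coxeter_length_eq_card_inversions[OF y]
        coxeter_length_eq_card_inversions[OF yx])
  with fin show ?thesis by simp
qed

lemma partial_order_left_weak_order: "partial_order (left_weak_order n)"
proof
  fix x y assume xy: "x \<in> carrier (left_weak_order n)" "y \<in> carrier (left_weak_order n)"
    "x \<sqsubseteq>\<^bsub>left_weak_order n\<^esub> y" "y \<sqsubseteq>\<^bsub>left_weak_order n\<^esub> x"
  then have eq: "inversions x = inversions y" and x: "x permutes {1..n}" and y: "y permutes {1..n}"
    by (auto simp: left_weak_order_le_iff symmetric_group_def)
  \<comment> \<open>For antisymmetry, equal inversion sets leave \<open>y \<circ> inv x\<close>
    without inversions, so it is the identity.\<close>
  have yx: "y \<circ> inv x permutes {1..n}"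
    by (rule permutes_compose[OF permutes_inv[OF x] y])
  have comp: "y \<circ> inv x \<circ> x = y" using x by (simp add: comp_assoc permutes_inv_o)
  then have "card (inversions (y \<circ> inv x)) = 0"
    using card_inversions_comp[OF yx x] eq by simp
  then have "y \<circ> inv x = id"
    using finite_inversions[OF yx] inversions_empty_imp_id[OF yx] by simp
  with comp show "x .=\<^bsub>left_weak_order n\<^esub> y" by simp
qed (auto simp: left_weak_order_le_iff)

section \<open>Existence of meets\<close>

text \<open>The permutation sends each element to its rank: one plus the number of its predecessors
  under \<open>R\<close>.\<close>

lemma ex_permutation_of_total_order:
  fixes R :: "nat \<Rightarrow> nat \<Rightarrow> bool"
  assumes irrefl: "\<And>i. i \<in> {1..n} \<Longrightarrow> \<not> R i i"
    and trans: "\<And>i j k. \<lbrakk>i \<in> {1..n}; j \<in> {1..n}; k \<in> {1..n}; R i j; R j k\<rbrakk> \<Longrightarrow> R i k"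
    and total: "\<And>i j. \<lbrakk>i \<in> {1..n}; j \<in> {1..n}; i \<noteq> j\<rbrakk> \<Longrightarrow> R i j \<or> R j i"
  obtains w where "w permutes {1..n}"
    "\<And>i j. \<lbrakk>i \<in> {1..n}; j \<in> {1..n}\<rbrakk> \<Longrightarrow> w i < w j \<longleftrightarrow> R i j"
proof -
  define B where "B i = {j \<in> {1..n}. R j i}" for i
  define w where "w i = (if i \<in> {1..n} then Suc (card (B i)) else i)" for i
  have mono: "w i < w j" if "i \<in> {1..n}" "j \<in> {1..n}" "R i j" for i j
  proof -
    have "B i \<subset> B j" using that irrefl trans unfolding B_def by blast
    then have "card (B i) < card (B j)" by (intro psubset_card_mono) (auto simp: B_def)
    with that show ?thesis by (simp add: w_def)
  qed
  have iff: "w i < w j \<longleftrightarrow> R i j" if "i \<in> {1..n}" "j \<in> {1..n}" for i j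
    using that mono total by (metis less_asym less_irrefl_nat)
  have inj: "inj_on w {1..n}"
    by (rule inj_onI) (metis less_irrefl_nat mono total)
  have "w ` {1..n} \<subseteq> {1..n}"
  proof
    fix y assume "y \<in> w ` {1..n}"
    then obtain i where i: "i \<in> {1..n}" "y = w i" by auto
    then have "B i \<subset> {1..n}" using irrefl unfolding B_def by blast
    then have "card (B i) < n" using psubset_card_mono[of "{1..n}" "B i"] by simp
    with i show "y \<in> {1..n}" by (auto simp: w_def)
  qed
  then have "bij_betw w {1..n} {1..n}"
    using inj by (simp add: bij_betw_def endo_inj_surj)
  then have "w permutes {1..n}" by (rule bij_imp_permutes) (auto simp: w_def)
  with iff that show ?thesis by blast
qed

text \<open>The non-inversions of the meet are the transitive closure of the union of the
  non-inversions of the two permutations; the complement of that closure is again transitive.\<close>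

lemma ex_meet_permutation:
  assumes x: "x permutes {1..n}" and y: "y permutes {1..n}"
  obtains m where "m permutes {1..n}" "inversions m \<subseteq> inversions x \<inter> inversions y"
    "\<And>z. \<lbrakk>z permutes {1..n}; inversions z \<subseteq> inversions x \<inter> inversions y\<rbrakk> \<Longrightarrow>
       inversions z \<subseteq> inversions m"
proof -
  define M where "M = {(i, j). i \<in> {1..n} \<and> j \<in> {1..n} \<and> i < j \<and> (x i < x j \<or> y i < y j)}"
  define N where "N = M\<^sup>+"
  have inj: "x a = x b \<longleftrightarrow> a = b" "y a = y b \<longleftrightarrow> a = b" for a b
    using x y by (metis permutes_inverses(2))+
  have N_less: "i < j" if "(i, j) \<in> N" for i j
    using that unfolding N_def by (induction rule: trancl_induct) (auto simp: M_def)
  have N_trans: "(i, k) \<in> N" if "(i, j) \<in> N" "(j, k) \<in> N" for i j k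
    using that unfolding N_def by (rule trancl_trans)
  have M_cotrans: "(i, j) \<in> M \<or> (j, k) \<in> M" if "(i, k) \<in> M" "i < j" "j < k" for i j k
  proof -
    have "x i < x k \<Longrightarrow> x i < x j \<or> x j < x k" "y i < y k \<Longrightarrow> y i < y j \<or> y j < y k" by auto
    with that show ?thesis unfolding M_def by auto
  qed
  have MN: "M \<subseteq> N" by (auto simp: N_def)
  \<comment> \<open>This says that the complement of \<open>N\<close> is transitive. The induction
    follows a chain in \<open>M\<close>: a point \<open>j\<close> before the last link is handled by
    the induction hypothesis, a point inside the last link by \<open>M_cotrans\<close>.\<close>
  have N_cotrans: "(i, j) \<in> N \<or> (j, k) \<in> N" if "(i, k) \<in> N" "i < j" "j < k" for i j k
    using that(1)[unfolded N_def] that(2,3)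
  proof (induction arbitrary: j rule: trancl_induct)
    case (base k)
    then show ?case using M_cotrans MN by blast
  next
    case (step b k)
    have ib: "(i, b) \<in> N" and bk: "(b, k) \<in> N" using step.hyps MN by (auto simp: N_def)
    consider "j < b" | "j = b" | "b < j" by linarith
    then show ?case
    proof cases
      case 1
      then show ?thesis using step.IH[of j] step.prems(1) bk N_trans by blast
    next
      case 2
      then show ?thesis using ib by simp
    next
      case 3
      then show ?thesis using M_cotrans[OF step.hyps(2) 3 step.prems(2)] MN ib N_trans by blast
    qed
  qed
  \<comment> \<open>\<open>R i j\<close> is to mean \<open>m i < m j\<close>: pairs in
    \<open>N\<close> keep their order and all other pairs are inverted.\<close>
  define R where "R i j \<longleftrightarrow> (i < j \<and> (i, j) \<in> N) \<or> (j < i \<and> (j, i) \<notin> N)" for i j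
  obtain m where m: "m permutes {1..n}"
    and mR: "\<And>i j. \<lbrakk>i \<in> {1..n}; j \<in> {1..n}\<rbrakk> \<Longrightarrow> m i < m j \<longleftrightarrow> R i j"
  proof (rule ex_permutation_of_total_order[of n R])
    fix i j k assume R: "R i j" "R j k"
    then have "i \<noteq> k" by (auto simp: R_def)
    \<comment> \<open>If \<open>i < k\<close>, transitivity of \<open>N\<close> settles a
      \<open>j\<close> between them and cotransitivity a \<open>j\<close> outside. If
      \<open>k < i\<close>, the two roles are exchanged.\<close>
    then consider "i < k" | "k < i" by linarith
    then show "R i k"
    proof cases
      case 1
      then have "\<not> (k < j \<and> j < i)" by linarith
      then have "(i, k) \<in> N"
        using R 1 N_trans[of i j k] N_cotrans[of i j k] N_cotrans[of j k i]
        unfolding R_def by blast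
      with 1 show ?thesis by (simp add: R_def)
    next
      case 2
      then have "\<not> (i < j \<and> j < k)" by linarith
      then have "(k, i) \<notin> N"
        using R 2 N_trans[of j k i] N_trans[of k i j] N_cotrans[of k i j]
        unfolding R_def by blast
      with 2 show ?thesis by (simp add: R_def)
    qed
  qed (auto simp: R_def)
  have inv_m: "(i, j) \<in> inversions m \<longleftrightarrow> i \<in> {1..n} \<and> j \<in> {1..n} \<and> i < j \<and> (i, j) \<notin> N" for i j
  proof (cases "i \<in> {1..n} \<and> j \<in> {1..n}")
    case True
    then show ?thesis using mR[of j i] by (auto simp: inversions_def R_def)
  next
    case False
    then show ?thesis using inversions_subset[OF m] by blast
  qed
  show thesis
  proof (rule that[OF m])
    show "inversions m \<subseteq> inversions x \<inter> inversions y"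
    proof (rule subrelI)
      fix i j assume "(i, j) \<in> inversions m"
      then have ij: "i \<in> {1..n}" "j \<in> {1..n}" "i < j" "(i, j) \<notin> M" using inv_m MN by auto
      then have "\<not> x i < x j" "\<not> y i < y j" by (auto simp: M_def)
      then show "(i, j) \<in> inversions x \<inter> inversions y"
        using ij(3) inj[of i j] by (auto simp: inversions_def)
    qed
  next
    fix z assume z: "z permutes {1..n}" and sub: "inversions z \<subseteq> inversions x \<inter> inversions y"
    have injz: "z a = z b \<longleftrightarrow> a = b" for a b using z by (metis permutes_inverses(2))
    \<comment> \<open>A lower bound \<open>z\<close> inverts nothing in \<open>M\<close>; being an
      order on values, this passes to the closure \<open>N\<close>.\<close>
    have M_z: "z i < z j" if "(i, j) \<in> M" for i j
    proof (rule ccontr)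
      assume "\<not> z i < z j"
      then have "(i, j) \<in> inversions z"
        using that injz[of i j] by (auto simp: M_def inversions_def)
      with sub that show False by (auto simp: M_def inversions_def)
    qed
    have "z i < z j" if "(i, j) \<in> N" for i j
      using that unfolding N_def
      by (induction rule: trancl_induct) (auto dest: M_z intro: less_trans)
    moreover have "i \<in> {1..n}" "j \<in> {1..n}" "i < j" "z j < z i"
      if "(i, j) \<in> inversions z" for i j
      using that subsetD[OF inversions_subset[OF z] that] by (auto simp: inversions_def)
    ultimately show "inversions z \<subseteq> inversions m"
      using inv_m by (meson less_asym subrelI)
  qed
qed

lemma lower_semilattice_left_weak_order: "lower_semilattice (left_weak_order n)"
proof -
  interpret partial_order "left_weak_order n" by (rule partial_order_left_weak_order)
  show ?thesis
  proof
    fix x y assume xy: "x \<in> carrier (left_weak_order n)" "y \<in> carrier (left_weak_order n)"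
    then have x: "x permutes {1..n}" and y: "y permutes {1..n}"
      by (auto simp: symmetric_group_def)
    have Lower: "Lower (left_weak_order n) {x, y} =
        {z. z permutes {1..n} \<and> inversions z \<subseteq> inversions x \<inter> inversions y}"
    proof -
      have "Lower (left_weak_order n) {x, y} =
          {z \<in> symmetric_group n. z \<sqsubseteq>\<^bsub>left_weak_order n\<^esub> x \<and> z \<sqsubseteq>\<^bsub>left_weak_order n\<^esub> y}"
        using xy unfolding Lower_def left_weak_order_simps by blast
      also have "\<dots> = {z \<in> symmetric_group n. inversions z \<subseteq> inversions x \<inter> inversions y}"
        using xy by (intro Collect_cong) (simp add: left_weak_order_le_iff cong: conj_cong)
      finally show ?thesis by (simp add: symmetric_group_def)
    qed
    show "\<exists>s. greatest (left_weak_order n) s (Lower (left_weak_order n) {x, y})"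
    proof (rule ex_meet_permutation[OF x y])
      fix m assume m: "m permutes {1..n}" "inversions m \<subseteq> inversions x \<inter> inversions y"
        and max: "\<And>z. \<lbrakk>z permutes {1..n}; inversions z \<subseteq> inversions x \<inter> inversions y\<rbrakk> \<Longrightarrow>
           inversions z \<subseteq> inversions m"
      have "z \<sqsubseteq>\<^bsub>left_weak_order n\<^esub> m"
        if "z permutes {1..n}" "inversions z \<subseteq> inversions x \<inter> inversions y" for z
        using max[OF that] that(1) m(1) left_weak_order_le_iff[of z n m]
        by (simp add: symmetric_group_def)
      with m have "greatest (left_weak_order n) m (Lower (left_weak_order n) {x, y})"
        unfolding greatest_def Lower left_weak_order_simps symmetric_group_def by blast
      then show "\<exists>s. greatest (left_weak_order n) s (Lower (left_weak_order n) {x, y})"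
        by (intro exI[of _ m])
    qed
  qed
qed

section \<open>Semilattice congruences and their minimal elements\<close>

context lower_semilattice
begin

lemma le_meet_iff:
  assumes "x \<in> carrier L" "y \<in> carrier L" "z \<in> carrier L"
  shows "z \<sqsubseteq> x \<sqinter> y \<longleftrightarrow> z \<sqsubseteq> x \<and> z \<sqsubseteq> y"
  using assms by (meson le_trans meet_closed meet_le meet_left meet_right)

text \<open>Lying above a fixed \<open>z\<close> is preserved and reflected by meets, so any family
  of such tests defines a congruence.\<close>

lemma semilattice_congruence_filters:
  assumes "Z \<subseteq> carrier L"
  shows "semilattice_congruence L
    {(x, y). x \<in> carrier L \<and> y \<in> carrier L \<and> (\<forall>z\<in>Z. z \<sqsubseteq> x \<longleftrightarrow> z \<sqsubseteq> y)}"
proof -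
  have "z \<in> carrier L" if "z \<in> Z" for z using that assms by blast
  then show ?thesis
    unfolding semilattice_congruence_def
    by (auto simp: le_meet_iff intro!: equivI refl_onI symI transI)
qed

lemma pi_down_eqI:
  assumes "r `` {w} \<subseteq> carrier L" "u \<in> r `` {w}" "\<And>v. v \<in> r `` {w} \<Longrightarrow> u \<sqsubseteq> v"
  shows "pi_down L r w = u"
  unfolding pi_down_def using assms by (intro the_equality) (auto intro: le_antisym)

text \<open>Since \<open>w \<sqinter> w = w\<close>, the class of \<open>w\<close> is closed under
  meets. Being finite, it has a least element, which is therefore its only minimal one.\<close>

lemma pi_down_properties:
  assumes fin: "finite (carrier L)" and r: "semilattice_congruence L r" and w: "w \<in> carrier L"
  shows "(w, pi_down L r w) \<in> r" "pi_down L r w \<in> carrier L" "pi_down L r w \<sqsubseteq> w"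
proof -
  have equiv: "equiv (carrier L) r"
    and cong: "\<And>x1 x2 y1 y2. \<lbrakk>(x1, x2) \<in> r; (y1, y2) \<in> r\<rbrakk> \<Longrightarrow> (x1 \<sqinter> y1, x2 \<sqinter> y2) \<in> r"
    using r by (auto simp: semilattice_congruence_def)
  let ?C = "r `` {w}"
  have sub: "?C \<subseteq> carrier L" using equiv by (auto simp: equiv_def refl_on_def)
  have "w \<in> ?C" using equiv_class_self[OF equiv w] .
  have meet_idem: "x \<sqinter> x = x" if "x \<in> carrier L" for x
    using that meet_left[OF that that] meet_closed[OF that that] le_meet_iff[OF that that that]
    by (intro le_antisym) auto
  have meet_C: "a \<sqinter> b \<in> ?C" if "a \<in> ?C" "b \<in> ?C" for a b
    using cong[of w a w b] that meet_idem[OF w] by simp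
  \<comment> \<open>Lower bounds inside the class are built for finite subsets \<open>A\<close>,
    then taken for \<open>A = ?C\<close>.\<close>
  have "\<exists>u\<in>?C. \<forall>a\<in>A. u \<sqsubseteq> a" if "finite A" "A \<subseteq> ?C" for A
    using that
  proof (induction A)
    case empty
    then show ?case using \<open>w \<in> ?C\<close> by blast
  next
    case (insert b A)
    then obtain u where u: "u \<in> ?C" "\<forall>a\<in>A. u \<sqsubseteq> a" by auto
    have "u \<sqinter> b \<sqsubseteq> a" if "a \<in> insert b A" for a
    proof -
      have "b \<in> carrier L" "u \<in> carrier L" "a \<in> carrier L" using that u insert.prems sub by auto
      then have "u \<sqinter> b \<sqsubseteq> u" "u \<sqinter> b \<sqsubseteq> b" "u \<sqinter> b \<in> carrier L"
        by (simp_all add: meet_left meet_right)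
      then show ?thesis
        using that u(2) \<open>u \<in> carrier L\<close> \<open>a \<in> carrier L\<close> by (auto intro: le_trans)
    qed
    then show ?case using meet_C[of u b] u insert.prems by blast
  qed
  from this[OF finite_subset[OF sub fin] subset_refl]
  obtain u where u: "u \<in> ?C" "\<forall>a\<in>?C. u \<sqsubseteq> a" by blast
  have "pi_down L r w = u" by (rule pi_down_eqI[OF sub u(1)]) (use u(2) in blast)
  with u sub \<open>w \<in> ?C\<close> show "(w, pi_down L r w) \<in> r" "pi_down L r w \<in> carrier L" "pi_down L r w \<sqsubseteq> w"
    by auto
qed

end

section \<open>The upper bound\<close>

lemma stack_sort_permutes:
  assumes "essential_congruence n r" "w \<in> symmetric_group n"
  shows "stack_sort n r w permutes {1..n}"
proof -
  interpret lower_semilattice "left_weak_order n" by (rule lower_semilattice_left_weak_order)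
  have "finite (symmetric_group n)" by (simp add: symmetric_group_def finite_permutations)
  then have "pi_down (left_weak_order n) r w permutes {1..n}"
    using pi_down_properties(2)[of r w] assms
    by (auto simp: essential_congruence_def symmetric_group_def)
  then show ?thesis
    using assms(2) by (auto simp: stack_sort_def symmetric_group_def intro: permutes_compose permutes_inv)
qed

lemma card_right_descents_stack_sort_le:
  assumes n: "n \<ge> 2" and r: "essential_congruence n r" and w: "w \<in> symmetric_group n"
  shows "card (right_descents n (stack_sort n r w)) \<le> n - 2"
proof -
  interpret lower_semilattice "left_weak_order n" by (rule lower_semilattice_left_weak_order)
  define u where "u = pi_down (left_weak_order n) r w"
  define v where "v = stack_sort n r w"
  have "finite (symmetric_group n)" by (simp add: symmetric_group_def finite_permutations)
  then have u: "(w, u) \<in> r" "u \<in> symmetric_group n" "u \<sqsubseteq>\<^bsub>left_weak_order n\<^esub> w"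
    using pi_down_properties[of r w] r w by (auto simp: essential_congruence_def u_def)
  have up: "u permutes {1..n}" using u(2) by (simp add: symmetric_group_def)
  have vu: "v (u i) = w i" for i
    using up by (simp add: v_def stack_sort_def u_def permutes_inverses)
  have vp: "v permutes {1..n}" unfolding v_def by (rule stack_sort_permutes[OF r w])
  let ?D = "{i \<in> {1..<n}. v (Suc i) < v i}"
  have "?D \<noteq> {1..<n}"
  proof
    assume "?D = {1..<n}"
    then have D: "v (Suc i) < v i" if "1 \<le> i" "i < n" for i
      using that by (metis (mono_tags, lifting) atLeastLessThan_iff mem_Collect_eq)
    \<comment> \<open>Descents at all positions make \<open>v\<close> order-reversing on
      \<open>{1..n}\<close>.\<close>
    have anti: "v b < v a" if "a < b" "1 \<le> a" "b \<le> n" for a b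
      using that(1)[THEN Suc_leI] that(3)
    proof (induction b rule: dec_induct)
      case base
      then show ?case using D[of a] that(2) by simp
    next
      case (step b)
      then show ?case using D[of b] that(2) by simp
    qed
    have "inversions u = {}"
    proof -
      \<comment> \<open>An inversion of \<open>u\<close> is undone by the reversal \<open>v\<close>,
        giving \<open>w i < w j\<close>, yet \<open>u \<le> w\<close> keeps it as an inversion of
        \<open>w\<close>.\<close>
      have False if ij: "(i, j) \<in> inversions u" for i j
      proof -
        have "i \<in> {1..n}" "j \<in> {1..n}" using ij inversions_subset[OF up] by auto
        then have "u i \<in> {1..n}" "u j \<in> {1..n}" using permutes_in_image[OF up] by auto
        then have "v (u i) < v (u j)" using ij anti by (simp add: inversions_def)
        moreover have "(i, j) \<in> inversions w"
          using u ij w by (auto simp: left_weak_order_le_iff)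
        ultimately show False by (simp add: vu inversions_def)
      qed
      then show ?thesis by auto
    qed
    then have "u = id" by (rule inversions_empty_imp_id[OF up])
    then have "w \<in> r `` {id}"
      using u(1) r by (auto simp: essential_congruence_def semilattice_congruence_def equiv_def dest: symD)
    then have "w = id" using r unfolding essential_congruence_def by blast
    \<comment> \<open>Now \<open>v\<close> is the identity, which has no descent at position 1; that
      position exists because \<open>n \<ge> 2\<close>.\<close>
    then have "v i = i" for i using vu[of i] \<open>u = id\<close> by simp
    then show False using anti[of 1 2] n by simp
  qed
  then have "?D \<subset> {1..<n}" by blast
  then have "card ?D < card {1..<n}" by (intro psubset_card_mono) auto
  then show ?thesis using card_right_descents[OF vp] by (simp add: v_def)
qed

section \<open>The extremal permutations\<close>

text \<open>In one-line notation \<open>1, k+1, 2, k+2, ...\<close>. It is used with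
  \<open>k = (n + 1) div 2\<close>, the number of odd positions, so that odd positions receive
  \<open>1..k\<close> and even ones the larger values.\<close>

definition shuffle :: "nat \<Rightarrow> nat \<Rightarrow> nat \<Rightarrow> nat" where
  "shuffle k n i = (if i \<in> {1..n} then if odd i then (i + 1) div 2 else k + i div 2 else i)"

text \<open>In one-line notation \<open>k, ..., 1, n, ..., k+1\<close>; for \<open>k \<le> n\<close>
  an involution preserving both blocks of values.\<close>

definition two_decreasing_runs :: "nat \<Rightarrow> nat \<Rightarrow> nat \<Rightarrow> nat" where
  "two_decreasing_runs k n i =
     (if i \<in> {1..k} then k + 1 - i else if i \<in> {k<..n} then n + k + 1 - i else i)"

lemma shuffle_permutes:
  assumes "k = (n + 1) div 2"
  shows "shuffle k n permutes {1..n}"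
proof (rule bij_imp_permutes)
  have "inj_on (shuffle k n) {1..n}"
  proof (rule inj_onI)
    fix i j assume "i \<in> {1..n}" "j \<in> {1..n}" "shuffle k n i = shuffle k n j"
    then show "i = j"
      using assms by (cases "odd i"; cases "odd j") (auto simp: shuffle_def elim!: evenE oddE)
  qed
  moreover have "shuffle k n ` {1..n} \<subseteq> {1..n}"
    using assms by (auto simp: shuffle_def elim!: evenE oddE)
  ultimately show "bij_betw (shuffle k n) {1..n} {1..n}"
    by (simp add: bij_betw_def endo_inj_surj)
qed (auto simp: shuffle_def)

lemma two_decreasing_runs_permutes:
  assumes "k \<le> n"
  shows "two_decreasing_runs k n permutes {1..n}"
proof (rule bij_imp_permutes)
  show "bij_betw (two_decreasing_runs k n) {1..n} {1..n}"
    by (rule bij_betw_byWitness[where f' = "two_decreasing_runs k n"])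
      (use assms in \<open>auto simp: two_decreasing_runs_def\<close>)
qed (use assms in \<open>auto simp: two_decreasing_runs_def\<close>)

text \<open>An inversion of the shuffle has an even position holding a value above \<open>k\<close>
  before an odd one holding a value at most \<open>k\<close>. Reversing each block separately keeps
  the blocks in order.\<close>

lemma inversions_shuffle_subset:
  assumes "k = (n + 1) div 2"
  shows "inversions (shuffle k n) \<subseteq> inversions (two_decreasing_runs k n \<circ> shuffle k n)"
proof (clarify)
  fix i j assume ij: "(i, j) \<in> inversions (shuffle k n)"
  then have *: "i < j" "shuffle k n j < shuffle k n i" by (auto simp: inversions_def)
  have "i \<in> {1..n}" "j \<in> {1..n}" using ij inversions_subset[OF shuffle_permutes[OF assms]] by auto
  with * have "even i" "odd j"
    using assms by (auto simp: shuffle_def elim!: evenE oddE split: if_splits)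
  with * \<open>i \<in> {1..n}\<close> \<open>j \<in> {1..n}\<close>
  show "(i, j) \<in> inversions (two_decreasing_runs k n \<circ> shuffle k n)"
    using assms by (auto simp: inversions_def shuffle_def two_decreasing_runs_def elim!: evenE oddE)
qed

text \<open>Adjacent positions hold values from different blocks, so reversal within the blocks does
  not affect their comparison.\<close>

lemma shuffle_descent_iff:
  assumes "k = (n + 1) div 2" "i \<in> {1..<n}"
  shows "shuffle k n (Suc i) < shuffle k n i \<longleftrightarrow> even i"
    and "two_decreasing_runs k n (shuffle k n (Suc i)) < two_decreasing_runs k n (shuffle k n i)
      \<longleftrightarrow> even i"
  using assms by (cases "even i"; auto simp: shuffle_def two_decreasing_runs_def elim!: evenE oddE)+

text \<open>The only ascent is at \<open>k\<close>, where the value 1 is followed by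
  \<open>n\<close>.\<close>

lemma card_right_descents_two_decreasing_runs:
  assumes "1 \<le> k" "k < n"
  shows "card (right_descents n (two_decreasing_runs k n)) = n - 2"
proof -
  have "{i \<in> {1..<n}. two_decreasing_runs k n (Suc i) < two_decreasing_runs k n i} = {1..<n} - {k}"
    using assms by (auto simp: two_decreasing_runs_def)
  then show ?thesis
    using assms card_right_descents[OF two_decreasing_runs_permutes[of k n]] by simp
qed

section \<open>A congruence with a prescribed minimal element\<close>

lemma simple_gen_le_iff:
  assumes "i \<in> {1..<n}" "w \<in> symmetric_group n"
  shows "simple_gen i \<sqsubseteq>\<^bsub>left_weak_order n\<^esub> w \<longleftrightarrow> w (Suc i) < w i"
proof -
  have "simple_gen i \<in> symmetric_group n"
    using simple_gen_permutes[OF assms(1)] by (simp add: symmetric_group_def)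
  then show ?thesis
    using assms(2) left_weak_order_le_iff inversions_simple_gen by (auto simp: inversions_def)
qed

lemma ex_essential_congruence:
  assumes u: "u \<in> symmetric_group n" and w: "w \<in> symmetric_group n"
    and le: "u \<sqsubseteq>\<^bsub>left_weak_order n\<^esub> w"
    and desc: "\<And>i. i \<in> {1..<n} \<Longrightarrow> u (Suc i) < u i \<longleftrightarrow> w (Suc i) < w i"
  obtains r where "essential_congruence n r" "pi_down (left_weak_order n) r w = u"
proof -
  interpret lower_semilattice "left_weak_order n" by (rule lower_semilattice_left_weak_order)
  \<comment> \<open>Testing against the simple generators records the descents, which isolates the
    identity. Testing against \<open>u\<close> places the whole class of \<open>w\<close> above
    \<open>u\<close>.\<close>
  define Z where "Z = insert u (simple_gen ` {1..<n})"
  define r where "r = {(x, y). x \<in> symmetric_group n \<and> y \<in> symmetric_group n \<and>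
    (\<forall>z\<in>Z. z \<sqsubseteq>\<^bsub>left_weak_order n\<^esub> x \<longleftrightarrow> z \<sqsubseteq>\<^bsub>left_weak_order n\<^esub> y)}"
  have "Z \<subseteq> symmetric_group n"
    using u simple_gen_permutes by (auto simp: Z_def symmetric_group_def)
  then have cong: "semilattice_congruence (left_weak_order n) r"
    using semilattice_congruence_filters[of Z] by (simp add: r_def)
  have id: "id \<in> symmetric_group n" by (simp add: symmetric_group_def permutes_id)
  have "x = id" if "(id, x) \<in> r" for x
  proof (rule no_descent_imp_id)
    show "x permutes {1..n}" using that by (simp add: r_def symmetric_group_def)
    fix i assume i: "i \<in> {1..<n}"
    then have "simple_gen i \<sqsubseteq>\<^bsub>left_weak_order n\<^esub> id \<longleftrightarrow> simple_gen i \<sqsubseteq>\<^bsub>left_weak_order n\<^esub> x"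
      using that by (auto simp: r_def Z_def)
    then show "x i \<le> x (Suc i)"
      using simple_gen_le_iff[OF i] id that by (auto simp: r_def)
  qed
  then have "r `` {id} = {id}" using id by (auto simp: r_def)
  with cong have "essential_congruence n r" by (simp add: essential_congruence_def)
  moreover have "pi_down (left_weak_order n) r w = u"
  proof (rule pi_down_eqI)
    show "r `` {w} \<subseteq> carrier (left_weak_order n)" by (auto simp: r_def)
    show "u \<in> r `` {w}"
      using u w le desc by (auto simp: r_def Z_def simple_gen_le_iff)
    show "u \<sqsubseteq>\<^bsub>left_weak_order n\<^esub> v" if "v \<in> r `` {w}" for v
      using that le by (auto simp: r_def Z_def)
  qed
  ultimately show ?thesis by (rule that)
qed

theorem theorem5p2:
  fixes n :: nat
  assumes "n \<ge> 2"
  shows "Max ((\<lambda>r. Max ((\<lambda>w. card (right_descents n (stack_sort n r w))) ` symmetric_group n))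
           ` {r. essential_congruence n r}) = n - 2"
proof -
  define k where "k = (n + 1) div 2"
  define u where "u = shuffle k n"
  define v where "v = two_decreasing_runs k n"
  define w where "w = v \<circ> u"
  \<comment> \<open>For \<open>n = 2\<close> this gives \<open>k = 1\<close> and all three
    permutations are the identity, in accordance with the value 0.\<close>
  have k: "1 \<le> k" "k < n" "k \<le> n" using assms by (auto simp: k_def)
  have up: "u permutes {1..n}" unfolding u_def by (rule shuffle_permutes[OF k_def])
  have vp: "v permutes {1..n}" unfolding v_def by (rule two_decreasing_runs_permutes[OF k(3)])
  have u: "u \<in> symmetric_group n" and w: "w \<in> symmetric_group n"
    using up permutes_compose[OF up vp] by (auto simp: symmetric_group_def w_def)
  have "u \<sqsubseteq>\<^bsub>left_weak_order n\<^esub> w"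
    using inversions_shuffle_subset[OF k_def] left_weak_order_le_iff[OF u w]
    by (simp add: u_def v_def w_def)
  moreover have "u (Suc i) < u i \<longleftrightarrow> w (Suc i) < w i" if "i \<in> {1..<n}" for i
    using shuffle_descent_iff[OF k_def that] by (simp add: u_def v_def w_def)
  ultimately obtain r where r: "essential_congruence n r" "pi_down (left_weak_order n) r w = u"
    using ex_essential_congruence[OF u w] by blast
  have "stack_sort n r w = v"
    unfolding stack_sort_def r(2) unfolding w_def
    by (simp add: comp_assoc permutes_inv_o(1)[OF up])
  moreover have "card (right_descents n v) = n - 2"
    unfolding v_def using k assms by (intro card_right_descents_two_decreasing_runs) auto
  ultimately have attained: "card (right_descents n (stack_sort n r w)) = n - 2" by simp
  let ?f = "\<lambda>r. Max ((\<lambda>w. card (right_descents n (stack_sort n r w))) ` symmetric_group n)"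
  have fin: "finite (symmetric_group n)" by (simp add: symmetric_group_def finite_permutations)
  have le: "?f r' \<le> n - 2" if "essential_congruence n r'" for r'
    using card_right_descents_stack_sort_le[OF assms that] fin w by (subst Max_le_iff) auto
  have "?f r = n - 2"
    using card_right_descents_stack_sort_le[OF assms r(1)] fin w attained
    by (intro Max_eqI) (auto simp: image_iff intro: bexI[of _ w])
  \<comment> \<open>Finiteness of the set of values comes from their common bound rather than from
    counting congruences.\<close>
  moreover have "finite (?f ` {r. essential_congruence n r})"
    by (rule finite_subset[of _ "{..n - 2}"]) (use le in auto)
  ultimately show ?thesis
    using le r(1) by (intro Max_eqI) (auto simp: image_iff intro!: exI[of _ r])
qed

end
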